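(* Let $X$ be a normed linear space, let $x,y\in X$ be non-zero, and let $\delta,\varepsilon\in[0,1)$ with $\varepsilon<(1-\delta)^2$. The following conditions are equivalent: (i) $x\perp_\delta^\varepsilon y$. (ii) There exists $f\in X^*\setminus\{0\}$ such that $f(x)$ is real, $f(x)\ge(1-\delta)\|f\|\|x\|$ and $|f(y)|\le\frac{\varepsilon}{1-\delta}\|f\|\|y\|$. (iii) There exists $f\in X^*\setminus\{0\}$ such that $\mathrm{Re}\,f(x)\ge(1-\delta)\|f\|\|x\|$ and $|f(y)|\le\frac{\varepsilon}{1-\delta}\|f\|\|y\|$. (iv) $\|x+\lambda y\|\ge(1-\delta)\|x\|-\frac{\varepsilon}{1-\delta}|\lambda|\|y\|$ for all scalars $\lambda$. Moreover, if $X$ is a Hilbert space, then (i)--(iv) are further equivalent to each of: (v) $|\langle x,y\rangle|\le L(\delta,\varepsilon)\|x\|\|y\|$, where $L(\delta,\varepsilon)=\cos(\theta_\varepsilon-\theta_\delta)$. (vi) There exists $u\in S_X$ such that $\langle x,u\rangle$ is real with $\langle x,u\rangle\ge(1-\delta)\|x\|$, and $|\langle y,u\rangle|\le\frac{\varepsilon}{1-\delta}\|y\|$.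
   Context: All normed linear spaces are over $\mathbb{C}$. $X^*$ is the topological dual of $X$ and $S_X$ is the unit sphere of $X$. For $\delta,\varepsilon\in[0,1)$ with $\varepsilon<(1-\delta)^2$ and $x,y\in X$, one says that $x$ is $(\delta,\varepsilon)$-norming approximately orthogonal to $y$, written $x\perp_\delta^\varepsilon y$, if there exists $f\in X^*\setminus\{0\}$ with $|f(x)|\ge(1-\delta)\|f\|\|x\|$ and $|f(y)|\le\frac{\varepsilon}{1-\delta}\|f\|\|y\|$. The angles $\theta_\delta\in[0,\frac{\pi}{2})$ and $\theta_\varepsilon\in(0,\frac{\pi}{2}]$ are defined by $\cos\theta_\delta=1-\delta$ and $\cos\theta_\varepsilon=\frac{\varepsilon}{1-\delta}$. *)

theory Defs
  imports "HOL-Analysis.Analysis"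
begin

text \<open>
  The library has only real normed spaces. A complex normed space is a real one together with a
  complex scalar multiplication that extends the real one and for which the norm is absolutely
  homogeneous. Completeness is not assumed.
\<close>

class complex_normed_vector = real_normed_vector +
  fixes scaleC :: "complex \<Rightarrow> 'a \<Rightarrow> 'a"  (infixr "*\<^sub>C" 75)
  assumes scaleC_add_right: "a *\<^sub>C (x + y) = a *\<^sub>C x + a *\<^sub>C y"
    and scaleC_add_left: "(a + b) *\<^sub>C x = a *\<^sub>C x + b *\<^sub>C x"
    and scaleC_scaleC: "a *\<^sub>C (b *\<^sub>C x) = (a * b) *\<^sub>C x"
    and scaleC_of_real: "complex_of_real r *\<^sub>C x = r *\<^sub>R x"
    and norm_scaleC: "norm (a *\<^sub>C x) = cmod a * norm x"

instantiation complex :: complex_normed_vector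
begin

definition scaleC_complex :: "complex \<Rightarrow> complex \<Rightarrow> complex"
  where "scaleC_complex a x = a * x"

instance
  by standard (simp_all add: scaleC_complex_def algebra_simps norm_mult scaleR_conv_of_real)

end

text \<open>
  The library's \<open>bounded_linear\<close> is real-linearity plus boundedness; complex homogeneity is
  added to it. The norm of a functional is the library's operator norm \<open>onorm\<close>, which depends
  only on the norms of the two spaces.
\<close>

definition topological_dual :: "('a::complex_normed_vector \<Rightarrow> complex) set"
  where "topological_dual = {f. bounded_linear f \<and> (\<forall>c x. f (c *\<^sub>C x) = c * f x)}"

text \<open>Meant for \<open>\<delta>, \<epsilon> \<in> [0,1)\<close> with \<open>\<epsilon> < (1 - \<delta>)\<^sup>2\<close>.\<close>

definition norming_approx_orth ::
    "real \<Rightarrow> real \<Rightarrow> 'a::complex_normed_vector \<Rightarrow> 'a \<Rightarrow> bool"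
  where "norming_approx_orth \<delta> \<epsilon> x y \<longleftrightarrow>
    (\<exists>f \<in> topological_dual - {\<lambda>_. 0}.
       cmod (f x) \<ge> (1 - \<delta>) * onorm f * norm x \<and>
       cmod (f y) \<le> \<epsilon> / (1 - \<delta>) * onorm f * norm y)"

text \<open>
  The space is a Hilbert space with inner product \<open>ip\<close>, linear in the first argument.
  Positive definiteness is part of the requirement that \<open>ip\<close> induce the given norm.
\<close>

definition hilbert_space_with :: "('a::complex_normed_vector \<Rightarrow> 'a \<Rightarrow> complex) \<Rightarrow> bool"
  where "hilbert_space_with ip \<longleftrightarrow>
    (\<forall>u v w. ip (u + v) w = ip u w + ip v w) \<and>
    (\<forall>c u v. ip (c *\<^sub>C u) v = c * ip u v) \<and>
    (\<forall>u v. ip v u = cnj (ip u v)) \<and>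
    (\<forall>u. ip u u = complex_of_real ((norm u)\<^sup>2)) \<and>
    complete (UNIV :: 'a set)"

definition angle_delta :: "real \<Rightarrow> real"
  where "angle_delta \<delta> = arccos (1 - \<delta>)"

definition angle_eps :: "real \<Rightarrow> real \<Rightarrow> real"
  where "angle_eps \<delta> \<epsilon> = arccos (\<epsilon> / (1 - \<delta>))"

definition L_const :: "real \<Rightarrow> real \<Rightarrow> real"
  where "L_const \<delta> \<epsilon> = cos (angle_eps \<delta> \<epsilon> - angle_delta \<delta>)"

text \<open>The two angles are characterised by their cosines and ranges.\<close>

lemma angle_delta_iff:
  assumes "0 \<le> \<delta>" "\<delta> < 1"
  shows "t = angle_delta \<delta> \<longleftrightarrow> t \<in> {0..<pi/2} \<and> cos t = 1 - \<delta>"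
proof
  assume t: "t = angle_delta \<delta>"
  have "arccos (1 - \<delta>) < arccos 0"
    using assms by (intro arccos_less_arccos) auto
  then show "t \<in> {0..<pi/2} \<and> cos t = 1 - \<delta>"
    using assms by (auto simp: t angle_delta_def intro: arccos_lbound)
next
  assume "t \<in> {0..<pi/2} \<and> cos t = 1 - \<delta>"
  then show "t = angle_delta \<delta>"
    using arccos_cos[of t] by (auto simp: angle_delta_def)
qed

lemma angle_eps_iff:
  assumes "0 \<le> \<delta>" "\<delta> < 1" "0 \<le> \<epsilon>" "\<epsilon> < (1 - \<delta>)\<^sup>2"
  shows "t = angle_eps \<delta> \<epsilon> \<longleftrightarrow> t \<in> {0<..pi/2} \<and> cos t = \<epsilon> / (1 - \<delta>)"
proof
  assume t: "t = angle_eps \<delta> \<epsilon>"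
  have "(1 - \<delta>)\<^sup>2 \<le> (1 - \<delta>) * 1"
    unfolding power2_eq_square using assms by (intro mult_left_mono) auto
  then have lt: "\<epsilon> / (1 - \<delta>) < 1" and ge: "0 \<le> \<epsilon> / (1 - \<delta>)"
    using assms by (auto simp: field_simps)
  have "arccos 1 < arccos (\<epsilon> / (1 - \<delta>))"
    using lt ge by (intro arccos_less_arccos) auto
  moreover have "arccos (\<epsilon> / (1 - \<delta>)) \<le> arccos 0"
    using lt ge by (intro arccos_le_arccos) auto
  moreover have "cos (arccos (\<epsilon> / (1 - \<delta>))) = \<epsilon> / (1 - \<delta>)"
    using lt ge by (intro cos_arccos) auto
  ultimately show "t \<in> {0<..pi/2} \<and> cos t = \<epsilon> / (1 - \<delta>)"
    by (simp add: t angle_eps_def)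
next
  assume "t \<in> {0<..pi/2} \<and> cos t = \<epsilon> / (1 - \<delta>)"
  then show "t = angle_eps \<delta> \<epsilon>"
    using arccos_cos[of t] by (auto simp: angle_eps_def)
qed

end

theory Submission imports Defs begin

text \<open>
  Rotating a functional by a unimodular scalar makes its value at \<open>x\<close> real without changing any
  absolute value, so (i), (ii) and (iii) say the same thing, and (i) gives (iv) by evaluating
  \<open>f\<close> at \<open>x + c y\<close>. The real content for normed spaces is the passage from (iv) back to a
  functional.

  Write \<open>a = (1 - \<delta>) \<parallel>x\<parallel>\<close> and \<open>b = \<epsilon> / (1 - \<delta>) \<parallel>y\<parallel>\<close>. Condition (iv) says that the sublinear
  functional \<open>q z = inf\<^sub>c (\<parallel>z + c y\<parallel> + b \<bar>c\<bar>)\<close> is at least \<open>a\<close> at \<open>x\<close>. By construction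
  \<open>q \<le> \<parallel>_\<parallel>\<close>, and \<open>q\<close> is at most \<open>b\<close> at unimodular multiples of \<open>y\<close>. A Hahn-Banach functional
  below \<open>q\<close> with the value \<open>q x\<close> at \<open>x\<close>, made complex-linear in the usual way, therefore has norm
  at most one and satisfies both inequalities with \<open>\<parallel>f\<parallel>\<close> replaced by one
  (\<open>ex_functional_of_dist_bound\<close>). This is not yet (iii): the bound on \<open>\<bar>f y\<bar>\<close> contains \<open>\<parallel>f\<parallel>\<close>, which
  may be smaller than one. Here \<open>\<epsilon> < (1 - \<delta>)\<^sup>2\<close> enters. Together with (iv) it makes the distance from
  \<open>x\<close> to the line of \<open>y\<close> positive, so the case \<open>b = 0\<close> of the same construction yields a functional
  \<open>g\<close> with \<open>g y = 0\<close> and \<open>Re (g x) > 0\<close>. Adding a nonnegative multiple of \<open>g\<close> keeps both inequalities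
  and, by continuity, brings the norm to exactly one (\<open>ex_functional_norm_one\<close>).

  The Hahn-Banach theorem itself is proved by applying Zorn's lemma to sublinear functionals,
  ordered pointwise: a minimal sublinear functional is linear.

  In a Hilbert space the cycle (iv), (v), (vi), (iii) is closed by plane trigonometry. Let \<open>\<phi>\<close> be
  the angle given by \<open>cos \<phi> = \<bar>\<langle>x,y\<rangle>\<bar> / (\<parallel>x\<parallel> \<parallel>y\<parallel>)\<close>, so that (v) says \<open>\<phi> \<ge> \<theta>\<^sub>\<epsilon> - \<theta>\<^sub>\<delta>\<close>. If this
  fails, the value of \<open>c\<close> that minimises \<open>\<parallel>x + c y\<parallel> + b \<bar>c\<bar>\<close> violates (iv). If it holds, then
  rotating \<open>x\<close> away from \<open>y\<close> in their plane until the angle to \<open>y\<close> is at least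
  \<open>\<theta>\<^sub>\<epsilon>\<close> moves it by an angle of at most \<open>\<theta>\<^sub>\<delta>\<close>, and the result is the unit vector of (vi). Its inner
  product functional has norm one, which gives (iii).
\<close>

section \<open>The Hahn-Banach theorem\<close>

text \<open>
  Only the inequality is demanded in the homogeneity clause, since it is the easier one to check
  for infima; the equality, for \<open>r \<ge> 0\<close>, follows by applying the clause to \<open>r\<close> and to \<open>1 / r\<close>.
\<close>

definition sublinear :: "('a::real_vector \<Rightarrow> real) \<Rightarrow> bool"
  where "sublinear p \<longleftrightarrow> (\<forall>u v. p (u + v) \<le> p u + p v) \<and> (\<forall>r>0. \<forall>u. p (r *\<^sub>R u) \<le> r * p u)"

lemma sublinear_add: "sublinear p \<Longrightarrow> p (u + v) \<le> p u + p v"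
  by (simp add: sublinear_def)

lemma sublinear_scaleR_le: "sublinear p \<Longrightarrow> r > 0 \<Longrightarrow> p (r *\<^sub>R u) \<le> r * p u"
  by (simp add: sublinear_def)

lemma sublinear_zero:
  assumes "sublinear p" shows "p 0 = 0"
  using sublinear_scaleR_le[OF assms, of 2 0] sublinear_scaleR_le[OF assms, of "1/2" 0] by simp

lemma sublinear_scaleR:
  assumes p: "sublinear p" and "r \<ge> 0" shows "p (r *\<^sub>R u) = r * p u"
proof (cases "r = 0")
  case False
  then have r: "r > 0" using assms by simp
  have "p (inverse r *\<^sub>R (r *\<^sub>R u)) \<le> inverse r * p (r *\<^sub>R u)"
    using r by (intro sublinear_scaleR_le[OF p]) simp
  then have "r * p u \<le> p (r *\<^sub>R u)"
    using r by (simp add: field_simps)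
  with sublinear_scaleR_le[OF p r, of u] show ?thesis by simp
qed (simp add: sublinear_zero[OF p])

lemma sublinear_lower:
  assumes "sublinear p" shows "- p (- u) \<le> p u"
  using sublinear_add[OF assms, of u "- u"] sublinear_zero[OF assms] by simp

text \<open>
  An infimum of sublinear functionals is not sublinear in general. What suffices is that the
  sublinearity inequalities hold up to a change of index, which covers both chains of sublinear
  functionals and infimal convolutions along a line.
\<close>

lemma sublinear_INF:
  fixes P :: "'i \<Rightarrow> 'a::real_vector \<Rightarrow> real"
  assumes "I \<noteq> {}" and bdd: "\<And>z. bdd_below ((\<lambda>i. P i z) ` I)"
    and add: "\<And>i j u v. i \<in> I \<Longrightarrow> j \<in> I \<Longrightarrow> \<exists>k\<in>I. P k (u + v) \<le> P i u + P j v"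
    and scale: "\<And>i r u. i \<in> I \<Longrightarrow> r > 0 \<Longrightarrow> \<exists>k\<in>I. P k (r *\<^sub>R u) \<le> r * P i u"
  shows "sublinear (\<lambda>z. INF i\<in>I. P i z)"
  unfolding sublinear_def
proof (intro conjI allI impI)
  let ?q = "\<lambda>z. INF i\<in>I. P i z"
  fix u v
  have *: "?q (u + v) \<le> P i u + P j v" if ij: "i \<in> I" "j \<in> I" for i j
  proof -
    obtain k where "k \<in> I" "P k (u + v) \<le> P i u + P j v" using add[OF ij] by blast
    then show ?thesis using cINF_lower2[OF bdd] by blast
  qed
  have "?q (u + v) - P j v \<le> ?q u" if "j \<in> I" for j
    using *[OF _ that] by (intro cINF_greatest[OF \<open>I \<noteq> {}\<close>]) (simp add: diff_le_eq)
  then have "?q (u + v) - ?q u \<le> ?q v"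
    by (intro cINF_greatest[OF \<open>I \<noteq> {}\<close>]) (simp add: algebra_simps)
  then show "?q (u + v) \<le> ?q u + ?q v" by simp
next
  let ?q = "\<lambda>z. INF i\<in>I. P i z"
  fix r :: real and u :: 'a assume r: "r > 0"
  have "?q (r *\<^sub>R u) / r \<le> ?q u"
  proof (intro cINF_greatest[OF \<open>I \<noteq> {}\<close>])
    fix i assume "i \<in> I"
    then obtain k where "k \<in> I" "P k (r *\<^sub>R u) \<le> r * P i u" using scale r by blast
    then have "?q (r *\<^sub>R u) \<le> r * P i u" using cINF_lower2[OF bdd] by blast
    then show "?q (r *\<^sub>R u) / r \<le> P i u" using r by (simp add: field_simps)
  qed
  then show "?q (r *\<^sub>R u) \<le> r * ?q u" using r by (simp add: field_simps)
qed

text \<open>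
  Lowering \<open>p\<close> to be linear along \<open>v\<close>: for a linear functional \<open>f\<close> below \<open>p\<close> with \<open>f v = p v\<close>, the
  inequality \<open>f (z + t v) \<le> p (z + t v)\<close> becomes \<open>f z \<le> p (z + t v) - t p v\<close>. The infimum of these
  bounds over \<open>t \<ge> 0\<close> is sublinear again and forces \<open>f v \<ge> p v\<close>.
\<close>

lemma sublinear_lower_along:
  assumes p: "sublinear p"
  obtains q where "sublinear q" "\<And>z. q z \<le> p z" "q (- v) \<le> - p v"
proof
  let ?P = "\<lambda>t z. p (z + t *\<^sub>R v) - t * p v"
  let ?q = "\<lambda>z. INF t\<in>{0..}. ?P t z"
  have bdd: "bdd_below ((\<lambda>t. ?P t z) ` {0..})" for z
  proof (rule bdd_belowI2)
    fix t :: real assume "t \<in> {0..}"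
    then show "- p (- z) \<le> ?P t z"
      using sublinear_add[OF p, of "z + t *\<^sub>R v" "- z"] sublinear_scaleR[OF p, of t v] by simp
  qed
  show "sublinear ?q"
  proof (rule sublinear_INF)
    fix s t :: real and u w assume "s \<in> {0..}" "t \<in> {0..}"
    then show "\<exists>k\<in>{0..}. ?P k (u + w) \<le> ?P s u + ?P t w"
      using sublinear_add[OF p, of "u + s *\<^sub>R v" "w + t *\<^sub>R v"]
      by (intro bexI[of _ "s + t"]) (auto simp: algebra_simps)
  next
    fix t r :: real and u assume "t \<in> {0..}" "r > 0"
    then show "\<exists>k\<in>{0..}. ?P k (r *\<^sub>R u) \<le> r * ?P t u"
      using sublinear_scaleR_le[OF p, of r "u + t *\<^sub>R v"]
      by (intro bexI[of _ "r * t"]) (auto simp: algebra_simps)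
  qed (use bdd in auto)
  show "?q z \<le> p z" for z
    using cINF_lower[OF bdd, of 0 z] by simp
  show "?q (- v) \<le> - p v"
    using cINF_lower[OF bdd, of 1 "- v"] sublinear_zero[OF p] by simp
qed

text \<open>
  Minimality means that lowering \<open>p\<close> along any \<open>v\<close> changes nothing, so \<open>p (- v) = - p v\<close>, and an odd
  sublinear functional is linear.
\<close>

lemma minimal_sublinear_imp_linear:
  assumes p: "sublinear p"
    and minimal: "\<And>q. sublinear q \<Longrightarrow> (\<And>z. q z \<le> p z) \<Longrightarrow> q = p"
  shows "linear p"
proof -
  have neg: "p (- v) = - p v" for v
  proof -
    obtain q where "sublinear q" "\<And>z. q z \<le> p z" "q (- v) \<le> - p v"
      using sublinear_lower_along[OF p] by blast
    with minimal[of q] sublinear_lower[OF p, of v] show ?thesis by force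
  qed
  show ?thesis
  proof (rule linearI)
    fix u v
    have "p (- u + - v) \<le> p (- u) + p (- v)" by (rule sublinear_add[OF p])
    then have "p u + p v \<le> p (u + v)" using neg[of "u + v"] by (simp add: neg)
    with sublinear_add[OF p, of u v] show "p (u + v) = p u + p v" by simp
  next
    fix r u
    show "p (r *\<^sub>R u) = r *\<^sub>R p u"
    proof (cases "r \<ge> 0")
      case False
      then have "p ((- r) *\<^sub>R u) = (- r) * p u" by (intro sublinear_scaleR[OF p]) simp
      then show ?thesis using neg[of "r *\<^sub>R u"] by simp
    qed (simp add: sublinear_scaleR[OF p])
  qed
qed

text \<open>
  The pointwise infimum of a chain of sublinear functionals below \<open>p\<close> is finite, because every such
  \<open>q\<close> satisfies \<open>q z \<ge> - q (- z) \<ge> - p (- z)\<close>.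
\<close>

lemma ex_linear_below_sublinear:
  fixes p :: "'a::real_vector \<Rightarrow> real"
  assumes p: "sublinear p"
  obtains f where "linear f" "\<And>z. f z \<le> p z"
proof -
  define A where "A = {q. sublinear q \<and> q \<le> p}"
  have "\<exists>m\<in>A. \<forall>q\<in>A. m \<ge> q \<longrightarrow> q = m"
  proof (rule predicate_Zorn)
    show "partial_order_on A (relation_of (\<ge>) A)"
      by (rule partial_order_on_relation_ofI) auto
    fix C assume C: "C \<in> Chains (relation_of (\<ge>) A)"
    show "\<exists>u\<in>A. \<forall>q\<in>C. q \<ge> u"
    proof (cases "C = {}")
      case True
      then show ?thesis using p by (auto simp: A_def)
    next
      case False
      have CA: "q \<in> A" if "q \<in> C" for q
        using C that by (auto simp: Chains_def relation_of_def)
      have total: "q \<le> q' \<or> q' \<le> q" if "q \<in> C" "q' \<in> C" for q q'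
        using C that by (auto simp: Chains_def relation_of_def)
      have bdd: "bdd_below ((\<lambda>q. q z) ` C)" for z
      proof (rule bdd_belowI2)
        fix q assume "q \<in> C"
        then have "sublinear q" "q (- z) \<le> p (- z)" using CA by (auto simp: A_def le_fun_def)
        then show "- p (- z) \<le> q z" using sublinear_lower[of q z] by linarith
      qed
      let ?u = "\<lambda>z. INF q\<in>C. q z"
      have "sublinear ?u"
      proof (rule sublinear_INF[OF False bdd])
        fix q q' u v assume q: "q \<in> C" "q' \<in> C"
        then have sub: "sublinear q" "sublinear q'" using CA by (auto simp: A_def)
        from total[OF q] show "\<exists>k\<in>C. k (u + v) \<le> q u + q' v"
        proof
          assume "q \<le> q'"
          then have "q v \<le> q' v" by (simp add: le_fun_def)
          with sublinear_add[OF sub(1), of u v] q show ?thesis by (intro bexI[of _ q]) auto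
        next
          assume "q' \<le> q"
          then have "q' u \<le> q u" by (simp add: le_fun_def)
          with sublinear_add[OF sub(2), of u v] q show ?thesis by (intro bexI[of _ q']) auto
        qed
      next
        fix q r u assume "q \<in> C" "(r::real) > 0"
        then show "\<exists>k\<in>C. k (r *\<^sub>R u) \<le> r * q u"
          using CA by (intro bexI[of _ q]) (auto simp: A_def sublinear_scaleR_le)
      qed
      moreover have below: "?u \<le> q" if "q \<in> C" for q
        using cINF_lower[OF bdd that] by (simp add: le_fun_def)
      moreover have "?u \<le> p"
        using False below CA by (auto simp: A_def intro: order_trans)
      ultimately show ?thesis by (intro bexI[of _ ?u]) (auto simp: A_def)
    qed
  qed
  then obtain m where m: "m \<in> A" "\<And>q. q \<in> A \<Longrightarrow> q \<le> m \<Longrightarrow> q = m" by blast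
  have "linear m"
  proof (rule minimal_sublinear_imp_linear)
    fix q assume "sublinear q" and le: "\<And>z. q z \<le> m z"
    moreover have "q \<le> m" using le by (simp add: le_fun_def)
    ultimately show "q = m" using m by (auto simp: A_def)
  qed (use m in \<open>simp add: A_def\<close>)
  with m that show ?thesis by (auto simp: A_def le_fun_def)
qed

text \<open>
  Lowering \<open>p\<close> along \<open>x\<close> before applying Zorn's lemma is what makes the value at \<open>x\<close> as large as
  possible.
\<close>

theorem Hahn_Banach_sublinear:
  fixes p :: "'a::real_vector \<Rightarrow> real"
  assumes p: "sublinear p"
  obtains f where "linear f" "\<And>z. f z \<le> p z" "f x = p x"
proof -
  obtain q where q: "sublinear q" "\<And>z. q z \<le> p z" "q (- x) \<le> - p x"
    using sublinear_lower_along[OF p] by blast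
  obtain f where f: "linear f" "\<And>z. f z \<le> q z"
    using ex_linear_below_sublinear[OF q(1)] by blast
  have le: "f z \<le> p z" for z using f(2)[of z] q(2)[of z] by linarith
  have "p x \<le> f x" using f(2)[of "- x"] q(3) linear_neg[OF f(1), of x] by simp
  with le[of x] have "f x = p x" by simp
  with f(1) le that show ?thesis by blast
qed

section \<open>Functionals on complex normed spaces\<close>

lemma ex_unimodular_mult_eq_cmod:
  obtains w where "cmod w = 1" "w * z = complex_of_real (cmod z)"
proof (cases "z = 0")
  case True
  then show ?thesis using that[of 1] by simp
next
  case False
  then show ?thesis using that[of "complex_of_real (cmod z) / z"] by (simp add: norm_divide)
qed

text \<open>
  The complex-linear functional with real part \<open>f\<close> is \<open>F z = f z - \<i> f (\<i> z)\<close>. Choosing \<open>w\<close>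
  unimodular with \<open>w F z = \<bar>F z\<bar>\<close> expresses \<open>\<bar>F z\<bar>\<close> as a value of \<open>f\<close>, so that one-sided bounds on
  \<open>f\<close> bound the modulus of \<open>F\<close>.
\<close>

lemma complexification:
  fixes f :: "'a::complex_normed_vector \<Rightarrow> real"
  assumes f: "linear f"
  obtains F :: "'a \<Rightarrow> complex" where "linear F" "\<And>c z. F (c *\<^sub>C z) = c * F z" "\<And>z. Re (F z) = f z"
    "\<And>z. \<exists>w. cmod w = 1 \<and> cmod (F z) = f (w *\<^sub>C z)"
proof
  let ?F = "\<lambda>z. Complex (f z) (- f (\<i> *\<^sub>C z))"
  have sR: "r *\<^sub>R z = complex_of_real r *\<^sub>C z" for r and z :: 'a by (simp add: scaleC_of_real)
  have fC: "f (c *\<^sub>C z) = Re c * f z + Im c * f (\<i> *\<^sub>C z)" for c z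
  proof -
    have "c *\<^sub>C z = Re c *\<^sub>R z + Im c *\<^sub>R (\<i> *\<^sub>C z)"
      unfolding sR scaleC_scaleC scaleC_add_left[symmetric]
      by (rule arg_cong[where f = "\<lambda>c. c *\<^sub>C z"]) (simp add: complex_eq_iff)
    then show ?thesis by (simp add: linear_add[OF f] linear_scale[OF f])
  qed
  show hom: "?F (c *\<^sub>C z) = c * ?F z" for c z
    by (simp add: complex_eq_iff fC[of c] fC[of "\<i> * c"] scaleC_scaleC)
  show "linear ?F"
  proof (rule linearI)
    show "?F (u + v) = ?F u + ?F v" for u v
      by (simp add: complex_eq_iff scaleC_add_right linear_add[OF f])
    show "?F (r *\<^sub>R u) = r *\<^sub>R ?F u" for r u
      using hom[of "complex_of_real r" u] by (simp only: sR) (simp add: scaleR_conv_of_real)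
  qed
  show "Re (?F z) = f z" for z by simp
  fix z
  obtain w where w: "cmod w = 1" "w * ?F z = complex_of_real (cmod (?F z))"
    using ex_unimodular_mult_eq_cmod by blast
  have "f (w *\<^sub>C z) = Re (?F (w *\<^sub>C z))" by simp
  also have "\<dots> = cmod (?F z)" unfolding hom w(2) by simp
  finally show "\<exists>w. cmod w = 1 \<and> cmod (?F z) = f (w *\<^sub>C z)" using w(1) by auto
qed

lemma topological_dual_linear: "f \<in> topological_dual \<Longrightarrow> linear f"
  by (auto simp: topological_dual_def bounded_linear_def)

lemma topological_dualI:
  assumes "linear F" "\<And>c z. F (c *\<^sub>C z) = c * F z" "\<And>z. cmod (F z) \<le> b * norm z"
  shows "F \<in> topological_dual"
  using assms by (auto simp: topological_dual_def bounded_linear_def bounded_linear_axioms_def mult.commute)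

text \<open>
  The functional is chosen below \<open>q z = inf\<^sub>c (\<parallel>z + c y\<parallel> + b \<bar>c\<bar>)\<close>, the largest sublinear functional
  that is at most the norm everywhere and at most \<open>b\<close> at all unimodular multiples of \<open>y\<close>. The
  assumption \<open>dist\<close> says that \<open>q x \<ge> a\<close>.
\<close>

lemma ex_functional_of_dist_bound:
  fixes x y :: "'a::complex_normed_vector"
  assumes b: "b \<ge> 0" and dist: "\<And>c. a \<le> norm (x + c *\<^sub>C y) + b * cmod c"
  obtains F where "F \<in> topological_dual" "\<And>z. cmod (F z) \<le> norm z" "a \<le> Re (F x)" "cmod (F y) \<le> b"
proof -
  let ?P = "\<lambda>c z. norm (z + c *\<^sub>C y) + b * cmod c"
  let ?q = "\<lambda>z. INF c. ?P c z"
  have bdd: "bdd_below (range (\<lambda>c. ?P c z))" for z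
    using b by (intro bdd_belowI2[of _ 0]) simp
  have "sublinear ?q"
  proof (rule sublinear_INF)
    fix c d :: complex and u v :: 'a
    have "norm (u + v + (c + d) *\<^sub>C y) \<le> norm (u + c *\<^sub>C y) + norm (v + d *\<^sub>C y)"
      using norm_triangle_ineq[of "u + c *\<^sub>C y" "v + d *\<^sub>C y"]
      by (simp add: scaleC_add_left algebra_simps)
    moreover have "b * cmod (c + d) \<le> b * cmod c + b * cmod d"
      using mult_left_mono[OF norm_triangle_ineq b] by (simp add: algebra_simps)
    ultimately show "\<exists>k\<in>UNIV. ?P k (u + v) \<le> ?P c u + ?P d v"
      by (intro bexI[of _ "c + d"]) auto
  next
    fix c :: complex and r :: real and u :: 'a assume r: "r > 0"
    have "r *\<^sub>R u + (complex_of_real r * c) *\<^sub>C y = r *\<^sub>R (u + c *\<^sub>C y)"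
      by (simp add: scaleC_scaleC[symmetric] scaleC_of_real scaleR_add_right)
    then have "?P (complex_of_real r * c) (r *\<^sub>R u) = r * ?P c u"
      using r by (simp only: norm_scaleR norm_mult norm_of_real) (simp add: algebra_simps)
    then show "\<exists>k\<in>UNIV. ?P k (r *\<^sub>R u) \<le> r * ?P c u"
      by (intro bexI[of _ "complex_of_real r * c"]) simp_all
  qed (use bdd in auto)
  then obtain f where f: "linear f" "\<And>z. f z \<le> ?q z" "f x = ?q x"
    using Hahn_Banach_sublinear by blast
  have f_le: "f z \<le> ?P c z" for c z
    using f(2)[of z] cINF_lower[OF bdd, of c z] by simp
  have "a \<le> f x" unfolding f(3) using dist by (intro cINF_greatest) auto
  obtain F where F: "linear F" "\<And>c z. F (c *\<^sub>C z) = c * F z" "\<And>z. Re (F z) = f z"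
    "\<And>z. \<exists>w. cmod w = 1 \<and> cmod (F z) = f (w *\<^sub>C z)"
    using complexification[OF f(1)] by blast
  have zero: "0 *\<^sub>C z = 0" for z :: 'a using scaleC_of_real[of 0 z] by simp
  have le: "cmod (F z) \<le> norm z" for z
  proof -
    obtain w where "cmod w = 1" "cmod (F z) = f (w *\<^sub>C z)" using F(4) by blast
    then show ?thesis using f_le[of "w *\<^sub>C z" 0] by (simp add: zero norm_scaleC)
  qed
  moreover have "cmod (F y) \<le> b"
  proof -
    obtain w where "cmod w = 1" "cmod (F y) = f (w *\<^sub>C y)" using F(4) by blast
    \<comment> \<open>The index \<open>c = - w\<close> cancels \<open>w y\<close> and leaves only \<open>b \<bar>w\<bar> = b\<close>.\<close>
    then show ?thesis using f_le[of "w *\<^sub>C y" "- w"]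
      by (simp add: scaleC_add_left[symmetric] zero)
  qed
  moreover have "F \<in> topological_dual"
    using topological_dualI[OF F(1,2), of 1] le by simp
  moreover have "a \<le> Re (F x)" using \<open>a \<le> f x\<close> F(3) by simp
  ultimately show ?thesis using that by blast
qed

text \<open>
  If \<open>x\<close> were close to \<open>- c y\<close>, then \<open>\<bar>c\<bar>\<close> would be close to \<open>\<parallel>x\<parallel> / \<parallel>y\<parallel>\<close>, and the assumed lower
  bound would force \<open>a\<close> down to about \<open>b \<parallel>x\<parallel> / \<parallel>y\<parallel>\<close>, against \<open>gap\<close>. Carrying the error through this
  estimate gives the explicit distance used as witness.
\<close>

lemma dist_line_pos:
  fixes x y :: "'a::complex_normed_vector"
  assumes b: "b \<ge> 0" and gap: "b * norm x < a * norm y"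
    and dist: "\<And>c. a \<le> norm (x + c *\<^sub>C y) + b * cmod c"
  obtains d where "d > 0" "\<And>c. d \<le> norm (x + c *\<^sub>C y)"
proof
  have y: "norm y > 0"
  proof (rule ccontr)
    assume "\<not> norm y > 0"
    then have "b * norm x < 0" using gap by simp
    then show False using b by (simp add: mult_less_0_iff)
  qed
  show "(a * norm y - b * norm x) / (norm y + b) > 0"
    using gap y b by (intro divide_pos_pos) linarith+
  fix c
  let ?D = "norm (x + c *\<^sub>C y)"
  have "cmod c * norm y \<le> ?D + norm x"
    using norm_triangle_ineq4[of "x + c *\<^sub>C y" x] by (simp add: norm_scaleC)
  then have 1: "b * (cmod c * norm y) \<le> b * (?D + norm x)"
    using b by (rule mult_left_mono)
  have 2: "a * norm y \<le> (?D + b * cmod c) * norm y"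
    using dist y by (intro mult_right_mono) auto
  have "a * norm y - b * norm x \<le> ?D * (norm y + b)"
    using 1 2 by (simp add: algebra_simps)
  then show "(a * norm y - b * norm x) / (norm y + b) \<le> ?D"
    using add_pos_nonneg[OF y b] by (simp add: pos_divide_le_eq)
qed

text \<open>
  Let \<open>F\<close> have norm at most one and satisfy the two inequalities, and let \<open>G\<close> vanish at \<open>y\<close> with
  \<open>Re (G x) \<ge> d > 0\<close>. Along \<open>F + t G\<close> for \<open>t \<ge> 0\<close> the value at \<open>y\<close> is constant and the real part at
  \<open>x\<close> grows, so the norm grows past one and equals one for some \<open>t\<close>.
\<close>

lemma ex_functional_norm_one:
  fixes x y :: "'a::complex_normed_vector"
  assumes b: "b \<ge> 0" and gap: "b * norm x < a * norm y"
    and dist: "\<And>c. a \<le> norm (x + c *\<^sub>C y) + b * cmod c"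
  obtains F where "F \<in> topological_dual" "onorm F = 1" "a \<le> Re (F x)" "cmod (F y) \<le> b"
proof -
  have "0 < a * norm y" using b gap by (meson mult_nonneg_nonneg norm_ge_zero order_le_less_trans)
  then have "a > 0" by (simp add: zero_less_mult_iff)
  moreover have "a \<le> norm x" using dist[of 0] scaleC_of_real[of 0 y] by simp
  ultimately have x: "norm x > 0" by linarith
  obtain F where F: "F \<in> topological_dual" "\<And>z. cmod (F z) \<le> norm z" "a \<le> Re (F x)" "cmod (F y) \<le> b"
    using ex_functional_of_dist_bound[OF b dist] by blast
  obtain d where d: "d > 0" "\<And>c. d \<le> norm (x + c *\<^sub>C y)"
    using dist_line_pos[OF b gap dist] by blast
  then obtain G where G: "G \<in> topological_dual" "d \<le> Re (G x)" "cmod (G y) \<le> 0"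
    using ex_functional_of_dist_bound[of 0 d x y] by (metis add.right_neutral mult_zero_left order_refl)
  have bl: "bounded_linear F" "bounded_linear G" using F G by (auto simp: topological_dual_def)
  let ?H = "\<lambda>t. Blinfun F + t *\<^sub>R Blinfun G"
  have H: "blinfun_apply (?H t) = (\<lambda>z. F z + t *\<^sub>R G z)" for t
    by (simp add: fun_eq_iff plus_blinfun.rep_eq scaleR_blinfun.rep_eq bounded_linear_Blinfun_apply bl)
  \<comment> \<open>At \<open>t = \<parallel>x\<parallel> / d\<close> the real part at \<open>x\<close> exceeds \<open>\<parallel>x\<parallel>\<close>, so the norm is at least one.\<close>
  have "\<exists>t. 0 \<le> t \<and> t \<le> norm x / d \<and> norm (?H t) = 1"
  proof (rule IVT')
    show "norm (?H 0) \<le> 1"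
      using F(2) by (intro norm_blinfun_bound) (simp_all add: bounded_linear_Blinfun_apply bl)
    have "norm x = norm x / d * d" using d by simp
    also have "\<dots> \<le> norm x / d * Re (G x)" using d G by (intro mult_left_mono) auto
    also have "\<dots> \<le> Re (?H (norm x / d) x)" unfolding H using F(3) \<open>a > 0\<close> by simp
    also have "\<dots> \<le> norm (?H (norm x / d)) * norm x"
      using complex_Re_le_cmod norm_blinfun order_trans by blast
    finally show "1 \<le> norm (?H (norm x / d))" using x by simp
    show "0 \<le> norm x / d" using d by simp
    show "continuous_on {0..norm x / d} (\<lambda>t. norm (?H t))" by (intro continuous_intros)
  qed
  then obtain t where t: "t \<ge> 0" "norm (?H t) = 1" by blast
  show ?thesis
  proof
    show "(\<lambda>z. F z + t *\<^sub>R G z) \<in> topological_dual"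
      using F G blinfun.bounded_linear_right[of "?H t"] unfolding H
      by (auto simp: topological_dual_def algebra_simps)
    show "onorm (\<lambda>z. F z + t *\<^sub>R G z) = 1"
      using t by (simp add: norm_blinfun.rep_eq H)
    show "a \<le> Re (F x + t *\<^sub>R G x)"
      using F(3) mult_nonneg_nonneg[OF t(1), of "Re (G x)"] G(2) d(1) by simp
    show "cmod (F y + t *\<^sub>R G y) \<le> b" using F(4) G(3) by simp
  qed
qed

lemma norm_ge_of_functional:
  assumes f: "f \<in> topological_dual" "f \<noteq> (\<lambda>_. 0)"
    and x: "k * onorm f * norm x \<le> cmod (f x)" and y: "cmod (f y) \<le> m * onorm f * norm y"
  shows "k * norm x - m * cmod c * norm y \<le> norm (x + c *\<^sub>C y)"
proof -
  have bl: "bounded_linear f" using f by (simp add: topological_dual_def)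
  have pos: "onorm f > 0" using f(2) by (auto simp: onorm_pos_lt[OF bl])
  have "f (x + c *\<^sub>C y) = f x + c * f y"
    using f(1) linear_add[OF topological_dual_linear[OF f(1)]] by (auto simp: topological_dual_def)
  then have "cmod (f x) - cmod (c * f y) \<le> cmod (f (x + c *\<^sub>C y))"
    using norm_diff_ineq[of "f x" "c * f y"] by simp
  also have "\<dots> \<le> onorm f * norm (x + c *\<^sub>C y)" by (rule onorm[OF bl])
  finally have "cmod (f x) - cmod c * cmod (f y) \<le> onorm f * norm (x + c *\<^sub>C y)"
    by (simp add: norm_mult)
  moreover have "cmod c * cmod (f y) \<le> cmod c * (m * onorm f * norm y)"
    using y by (intro mult_left_mono) auto
  ultimately have "onorm f * (k * norm x - m * cmod c * norm y) \<le> onorm f * norm (x + c *\<^sub>C y)"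
    using x by (simp add: algebra_simps)
  then show ?thesis using pos by simp
qed

lemma rotate_functional:
  assumes f: "f \<in> topological_dual - {\<lambda>_. 0}"
  obtains g where "g \<in> topological_dual - {\<lambda>_. 0}" "onorm g = onorm f"
    "g x = complex_of_real (cmod (f x))" "\<And>z. cmod (g z) = cmod (f z)"
proof -
  obtain w where w: "cmod w = 1" "w * f x = complex_of_real (cmod (f x))"
    using ex_unimodular_mult_eq_cmod by blast
  have n: "cmod (w * f z) = cmod (f z)" for z by (simp add: norm_mult w)
  show ?thesis
  proof
    have "bounded_linear (\<lambda>z. w * f z)"
      using f by (intro bounded_linear_mult_right[THEN bounded_linear_compose]) (auto simp: topological_dual_def)
    then show "(\<lambda>z. w * f z) \<in> topological_dual - {\<lambda>_. 0}"
      using f w by (auto simp: topological_dual_def fun_eq_iff)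
    show "onorm (\<lambda>z. w * f z) = onorm f" by (simp add: onorm_def n)
  qed (use w n in auto)
qed

section \<open>An extremal problem in the plane\<close>

text \<open>
  For unit vectors \<open>x\<close>, \<open>y\<close> at angle \<open>\<phi>\<close>, the square root is \<open>\<parallel>x - r y\<parallel>\<close>. The function of \<open>r\<close> on
  the right is minimal where \<open>x - r y\<close> makes the angle \<open>\<eta>\<close> with \<open>y\<close>, so by the law of sines
  at \<open>r = sin (\<eta> - \<phi>) / sin \<eta>\<close>, and its minimum is \<open>cos (\<eta> - \<phi>)\<close>. Were \<open>\<phi> < \<eta> - \<theta>\<close>, this minimum
  would be smaller than \<open>cos \<theta>\<close>.
\<close>

lemma angle_diff_le_of_distance_bound:
  assumes \<phi>: "0 \<le> \<phi>" and \<eta>: "0 < \<eta>" "\<eta> \<le> pi / 2" and \<theta>: "0 \<le> \<theta>" "\<theta> \<le> \<eta>"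
    and dist: "\<And>r. r \<ge> 0 \<Longrightarrow> cos \<theta> \<le> sqrt (1 - 2 * r * cos \<phi> + r\<^sup>2) + r * cos \<eta>"
  shows "\<eta> - \<theta> \<le> \<phi>"
proof (rule ccontr)
  assume "\<not> \<eta> - \<theta> \<le> \<phi>"
  then have lt: "\<phi> < \<eta> - \<theta>" by simp
  have s: "sin \<eta> > 0" using \<eta> by (intro sin_gt_zero) auto
  have sp: "sin \<phi> \<ge> 0" using lt \<phi> \<eta> \<theta> by (intro sin_ge_zero) auto
  define r where "r = sin (\<eta> - \<phi>) / sin \<eta>"
  have r0: "r \<ge> 0" unfolding r_def using lt \<phi> \<eta> \<theta> s by (intro divide_nonneg_pos sin_ge_zero) auto
  have rs: "r * sin \<eta> = sin \<eta> * cos \<phi> - cos \<eta> * sin \<phi>"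
    unfolding r_def using s by (simp add: sin_diff)
  have "(1 - 2 * r * cos \<phi> + r\<^sup>2) * (sin \<eta>)\<^sup>2 = (sin \<eta>)\<^sup>2 - 2 * (r * sin \<eta>) * sin \<eta> * cos \<phi> + (r * sin \<eta>)\<^sup>2"
    by (simp add: algebra_simps power2_eq_square)
  also have "\<dots> = (sin \<phi>)\<^sup>2"
    unfolding rs using sin_cos_squared_add[of \<eta>] sin_cos_squared_add[of \<phi>] by algebra
  finally have "1 - 2 * r * cos \<phi> + r\<^sup>2 = (sin \<phi> / sin \<eta>)\<^sup>2"
    using s by (simp add: field_simps power_divide)
  then have "sqrt (1 - 2 * r * cos \<phi> + r\<^sup>2) = sin \<phi> / sin \<eta>"
    using s sp by simp
  with dist[OF r0] have "cos \<theta> \<le> sin \<phi> / sin \<eta> + r * cos \<eta>" by simp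
  also have "\<dots> = (sin \<phi> + (r * sin \<eta>) * cos \<eta>) / sin \<eta>" using s by (simp add: field_simps)
  also have "sin \<phi> + (r * sin \<eta>) * cos \<eta> = cos (\<eta> - \<phi>) * sin \<eta>"
    unfolding rs cos_diff using sin_cos_squared_add[of \<eta>] by algebra
  finally have "cos \<theta> \<le> cos (\<eta> - \<phi>)" using s by simp
  moreover have "cos (\<eta> - \<phi>) < cos \<theta>" using lt \<phi> \<eta> \<theta> by (intro cos_monotone_0_pi) auto
  ultimately show False by simp
qed

section \<open>Complex inner products\<close>

locale complex_inner_product =
  fixes ip :: "'a::complex_normed_vector \<Rightarrow> 'a \<Rightarrow> complex"
  assumes add_left: "ip (u + v) w = ip u w + ip v w"
    and scale_left: "ip (c *\<^sub>C u) v = c * ip u v"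
    and conj: "ip v u = cnj (ip u v)"
    and self: "ip u u = complex_of_real ((norm u)\<^sup>2)"
begin

lemma add_right: "ip w (u + v) = ip w u + ip w v"
  using conj[of w "u + v"] conj[of w u] conj[of w v] by (simp add: add_left)

lemma scale_right: "ip u (c *\<^sub>C v) = cnj c * ip u v"
  using conj[of u "c *\<^sub>C v"] conj[of u v] by (simp add: scale_left)

lemma norm_sq_add: "(norm (u + v))\<^sup>2 = (norm u)\<^sup>2 + (norm v)\<^sup>2 + 2 * Re (ip u v)"
proof -
  have "complex_of_real ((norm (u + v))\<^sup>2) = ip (u + v) (u + v)" by (simp add: self)
  also have "\<dots> = complex_of_real ((norm u)\<^sup>2 + (norm v)\<^sup>2) + (ip u v + cnj (ip u v))"
    unfolding add_left add_right conj[of v u] by (simp add: self)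
  also have "\<dots> = complex_of_real ((norm u)\<^sup>2 + (norm v)\<^sup>2 + 2 * Re (ip u v))"
    by (simp add: complex_add_cnj)
  finally show ?thesis by (simp only: of_real_eq_iff)
qed

lemma Cauchy_Schwarz: "cmod (ip u v) \<le> norm u * norm v"
proof (cases "v = 0")
  case True
  then show ?thesis using scale_right[of u 0 v] scaleC_of_real[of 0 v] by simp
next
  case False
  let ?k = "(cmod (ip u v))\<^sup>2"
  \<comment> \<open>\<open>u + c v\<close> is the component of \<open>u\<close> orthogonal to \<open>v\<close>.\<close>
  define c where "c = - ip u v / complex_of_real ((norm v)\<^sup>2)"
  have "ip u (c *\<^sub>C v) = - complex_of_real (?k / (norm v)\<^sup>2)"
    unfolding scale_right c_def complex_norm_square of_real_divide by simp
  then have "(norm (u + c *\<^sub>C v))\<^sup>2 = (norm u)\<^sup>2 + (norm (c *\<^sub>C v))\<^sup>2 - 2 * (?k / (norm v)\<^sup>2)"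
    by (simp add: norm_sq_add)
  moreover have "cmod c = cmod (ip u v) / (norm v)\<^sup>2"
    by (simp add: c_def norm_divide norm_power)
  then have "(norm (c *\<^sub>C v))\<^sup>2 = ?k / (norm v)\<^sup>2"
    using False by (simp add: norm_scaleC power2_eq_square)
  ultimately have "?k / (norm v)\<^sup>2 \<le> (norm u)\<^sup>2"
    using zero_le_power2[of "norm (u + c *\<^sub>C v)"] by linarith
  then have "?k \<le> (norm u * norm v)\<^sup>2"
    using False by (simp add: pos_divide_le_eq power_mult_distrib)
  then show ?thesis by (rule power2_le_imp_le) simp
qed

text \<open>
  Both (iv) and (vi) are insensitive to the phase of \<open>y\<close>. Choosing it suitably, the normalised
  vectors have a real nonnegative inner product and behave like unit vectors of a real plane.
\<close>

lemma normalize_pair: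
  assumes "x \<noteq> 0" "y \<noteq> 0"
  obtains a b where "norm (a *\<^sub>C x) = 1" "norm (b *\<^sub>C y) = 1"
    "a = complex_of_real (1 / norm x)"
    "ip (a *\<^sub>C x) (b *\<^sub>C y) = complex_of_real (cmod (ip x y) / (norm x * norm y))" "cmod b = 1 / norm y"
proof -
  obtain w where w: "cmod w = 1" "w * ip x y = complex_of_real (cmod (ip x y))"
    using ex_unimodular_mult_eq_cmod by blast
  show ?thesis
  proof
    show "norm (complex_of_real (1 / norm x) *\<^sub>C x) = 1" using assms by (simp add: norm_scaleC norm_divide)
    show "cmod (cnj w / norm y) = 1 / norm y" using w by (simp add: norm_divide)
    then show "norm ((cnj w / norm y) *\<^sub>C y) = 1" using assms by (simp add: norm_scaleC)
    show "ip (complex_of_real (1 / norm x) *\<^sub>C x) ((cnj w / norm y) *\<^sub>C y) =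
        complex_of_real (cmod (ip x y) / (norm x * norm y))"
      using w by (simp add: scale_left scale_right mult.commute)
  qed simp
qed

text \<open>
  In the plane of \<open>x\<close> and \<open>y\<close>, place \<open>y\<close> in direction \<open>0\<close> and \<open>x\<close> in direction \<open>\<phi>\<close>; then \<open>u\<close> is the
  unit vector in direction \<open>\<eta>\<close>. Its coefficients are the solution of
  \<open>sin \<phi> u = sin \<eta> x - sin (\<eta> - \<phi>) y\<close>.
\<close>

lemma unit_vector_at_angles:
  assumes "norm x = 1" "norm y = 1" and xy: "ip x y = complex_of_real (cos \<phi>)"
    and \<phi>: "0 < \<phi>" "\<phi> < pi"
  obtains u where "norm u = 1" "ip x u = complex_of_real (cos (\<eta> - \<phi>))" "ip y u = complex_of_real (cos \<eta>)"
proof -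
  have s: "sin \<phi> > 0" using \<phi> by (rule sin_gt_zero)
  let ?A = "complex_of_real (sin \<eta> / sin \<phi>)" and ?B = "complex_of_real (- sin (\<eta> - \<phi>) / sin \<phi>)"
  let ?u = "?A *\<^sub>C x + ?B *\<^sub>C y"
  have yx: "ip y x = complex_of_real (cos \<phi>)" using conj[of y x] xy by simp
  have nrm: "ip x x = 1" "ip y y = 1" using assms self by auto
  have "sin \<eta> - sin (\<eta> - \<phi>) * cos \<phi> = cos (\<eta> - \<phi>) * sin \<phi>"
    unfolding sin_diff cos_diff using sin_cos_squared_add[of \<phi>] by algebra
  then have "sin \<eta> / sin \<phi> + (- sin (\<eta> - \<phi>) / sin \<phi>) * cos \<phi> = cos (\<eta> - \<phi>)"
    using s by (simp add: field_simps)
  moreover have "ip x ?u = complex_of_real (sin \<eta> / sin \<phi> + (- sin (\<eta> - \<phi>) / sin \<phi>) * cos \<phi>)"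
    by (simp add: add_right scale_right nrm xy)
  ultimately have xu: "ip x ?u = complex_of_real (cos (\<eta> - \<phi>))" by simp
  have "sin \<eta> * cos \<phi> - sin (\<eta> - \<phi>) = cos \<eta> * sin \<phi>"
    unfolding sin_diff by simp
  then have "(sin \<eta> / sin \<phi>) * cos \<phi> + (- sin (\<eta> - \<phi>) / sin \<phi>) = cos \<eta>"
    using s by (simp add: field_simps)
  moreover have "ip y ?u = complex_of_real ((sin \<eta> / sin \<phi>) * cos \<phi> + (- sin (\<eta> - \<phi>) / sin \<phi>))"
    by (simp add: add_right scale_right nrm yx)
  ultimately have yu: "ip y ?u = complex_of_real (cos \<eta>)" by simp
  have "sin \<eta> * cos (\<eta> - \<phi>) - sin (\<eta> - \<phi>) * cos \<eta> = sin \<phi>"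
    using sin_diff[of \<eta> "\<eta> - \<phi>"] by (simp add: mult.commute)
  then have "(sin \<eta> / sin \<phi>) * cos (\<eta> - \<phi>) + (- sin (\<eta> - \<phi>) / sin \<phi>) * cos \<eta> = 1"
    using s by (simp add: field_simps)
  moreover have "ip ?u ?u = ?A * ip x ?u + ?B * ip y ?u" by (simp only: add_left scale_left)
  then have "complex_of_real ((norm ?u)\<^sup>2) =
      complex_of_real ((sin \<eta> / sin \<phi>) * cos (\<eta> - \<phi>) + (- sin (\<eta> - \<phi>) / sin \<phi>) * cos \<eta>)"
    unfolding xu yu self by (simp only: of_real_add of_real_mult)
  ultimately have "(norm ?u)\<^sup>2 = 1" by (simp only: of_real_eq_iff)
  then have "norm ?u = 1" using power2_eq_iff_nonneg[of "norm ?u" 1] by (simp only: norm_ge_zero) simp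
  with xu yu that show ?thesis by blast
qed

lemma functional_of_vector:
  assumes "norm u = 1"
  shows "(\<lambda>z. ip z u) \<in> topological_dual - {\<lambda>_. 0}" "onorm (\<lambda>z. ip z u) = 1"
proof -
  have le: "cmod (ip z u) \<le> 1 * norm z" for z using Cauchy_Schwarz[of z u] assms by simp
  have hom: "ip (r *\<^sub>R z) u = r *\<^sub>R ip z u" for r z
    using scale_left[of "complex_of_real r" z u] by (simp add: scaleC_of_real scaleR_conv_of_real)
  have dual: "(\<lambda>z. ip z u) \<in> topological_dual"
    using le by (intro topological_dualI[of _ 1] linearI) (auto simp: add_left scale_left hom)
  have one: "ip u u = 1" using assms by (simp add: self)
  then have "(\<lambda>z. ip z u) \<noteq> (\<lambda>_. 0)" by (metis zero_neq_one)
  with dual show "(\<lambda>z. ip z u) \<in> topological_dual - {\<lambda>_. 0}" by simp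
  have bl: "bounded_linear (\<lambda>z. ip z u)" using dual by (simp add: topological_dual_def)
  have "onorm (\<lambda>z. ip z u) \<le> 1" using le by (intro onorm_bound) auto
  moreover have "1 \<le> onorm (\<lambda>z. ip z u)" using onorm[OF bl, of u] one assms by simp
  ultimately show "onorm (\<lambda>z. ip z u) = 1" by simp
qed

text \<open>
  After normalisation only scalars \<open>c\<close> of the phase that makes \<open>c y\<close> point against the projection
  of \<open>x\<close> are needed, which reduces the claim to the extremal problem in the plane.
\<close>

lemma angle_bound_of_norm_bound:
  assumes xy: "x \<noteq> 0" "y \<noteq> 0" and \<eta>: "0 < \<eta>" "\<eta> \<le> pi / 2" and \<theta>: "0 \<le> \<theta>" "\<theta> \<le> \<eta>"
    and bound: "\<And>c. cos \<theta> * norm x - cos \<eta> * cmod c * norm y \<le> norm (x + c *\<^sub>C y)"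
  shows "cmod (ip x y) \<le> cos (\<eta> - \<theta>) * norm x * norm y"
proof -
  obtain a b where n: "norm (a *\<^sub>C x) = 1" "norm (b *\<^sub>C y) = 1" and a: "a = complex_of_real (1 / norm x)"
    and ip: "ip (a *\<^sub>C x) (b *\<^sub>C y) = complex_of_real (cmod (ip x y) / (norm x * norm y))"
    and b: "cmod b = 1 / norm y"
    using normalize_pair[OF xy] by blast
  define s where "s = cmod (ip x y) / (norm x * norm y)"
  have s: "0 \<le> s" "s \<le> 1" using xy Cauchy_Schwarz[of x y] by (auto simp: s_def divide_le_eq)
  have "\<eta> - \<theta> \<le> arccos s"
  proof (rule angle_diff_le_of_distance_bound[OF _ \<eta> \<theta>])
    show "0 \<le> arccos s" using s by (intro arccos_lbound) auto
    fix r :: real assume r: "r \<ge> 0"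
    let ?c = "- complex_of_real r * b"
    have "(norm (a *\<^sub>C x + ?c *\<^sub>C y))\<^sup>2 = 1 - 2 * r * s + r\<^sup>2"
      using n ip xy b scale_right[of "a *\<^sub>C x" "- complex_of_real r" "b *\<^sub>C y"]
      by (simp add: norm_sq_add norm_scaleC scaleC_scaleC norm_mult s_def[symmetric])
    then have eq: "norm (a *\<^sub>C x + ?c *\<^sub>C y) = sqrt (1 - 2 * r * s + r\<^sup>2)"
      by (metis norm_ge_zero real_sqrt_unique)
    let ?c' = "complex_of_real (norm x) * ?c"
    have "a *\<^sub>C x + ?c *\<^sub>C y = a *\<^sub>C (x + ?c' *\<^sub>C y)"
      using xy by (simp add: scaleC_add_right scaleC_scaleC a)
    then have "norm (a *\<^sub>C x + ?c *\<^sub>C y) = norm (x + ?c' *\<^sub>C y) / norm x"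
      by (simp add: norm_scaleC a norm_divide)
    moreover have "cos \<theta> * norm x - cos \<eta> * cmod ?c' * norm y = (cos \<theta> - r * cos \<eta>) * norm x"
      using r xy by (simp add: norm_mult b algebra_simps)
    ultimately have "cos \<theta> - r * cos \<eta> \<le> norm (a *\<^sub>C x + ?c *\<^sub>C y)"
      using bound[of ?c'] xy by (simp add: pos_le_divide_eq)
    then show "cos \<theta> \<le> sqrt (1 - 2 * r * cos (arccos s) + r\<^sup>2) + r * cos \<eta>"
      using s unfolding eq by simp
  qed
  then have "cos (arccos s) \<le> cos (\<eta> - \<theta>)"
    using \<theta> s by (intro cos_monotone_0_pi_le arccos_ubound) auto
  then have "s \<le> cos (\<eta> - \<theta>)" using s by simp
  then show ?thesis using xy by (simp add: s_def pos_divide_le_eq algebra_simps)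
qed

text \<open>
  If \<open>x\<close> already makes an angle of at least \<open>\<eta>\<close> with the line of \<open>y\<close>, the normalised \<open>x\<close> serves.
  Otherwise it is rotated away from \<open>y\<close>, in their common plane, until that angle is \<open>\<eta>\<close>. The rotation
  angle \<open>\<eta> - \<phi>\<close> is at most \<open>\<theta>\<close> by the assumed bound.
\<close>

lemma ex_unit_vector_of_angle_bound:
  assumes xy: "x \<noteq> 0" "y \<noteq> 0" and \<eta>: "0 < \<eta>" "\<eta> \<le> pi / 2" and \<theta>: "0 \<le> \<theta>" "\<theta> < \<eta>"
    and angle: "cmod (ip x y) \<le> cos (\<eta> - \<theta>) * norm x * norm y"
  obtains u where "norm u = 1" "ip x u \<in> \<real>" "cos \<theta> * norm x \<le> Re (ip x u)" "cmod (ip y u) \<le> cos \<eta> * norm y"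
proof -
  obtain a b where n: "norm (a *\<^sub>C x) = 1" "norm (b *\<^sub>C y) = 1" and a: "a = complex_of_real (1 / norm x)"
    and ip: "ip (a *\<^sub>C x) (b *\<^sub>C y) = complex_of_real (cmod (ip x y) / (norm x * norm y))"
    and b: "cmod b = 1 / norm y"
    using normalize_pair[OF xy] by blast
  define s where "s = cmod (ip x y) / (norm x * norm y)"
  have s: "0 \<le> s" "s \<le> 1" using xy Cauchy_Schwarz[of x y] by (auto simp: s_def divide_le_eq)
  have s_le: "s \<le> cos (\<eta> - \<theta>)" using xy angle by (simp add: s_def pos_divide_le_eq algebra_simps)
  define \<phi> where "\<phi> = arccos s"
  have \<phi>: "cos \<phi> = s" "0 \<le> \<phi>" "\<phi> \<le> pi"
    using s by (auto simp: \<phi>_def intro: arccos_lbound arccos_ubound)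
  have le: "\<eta> - \<theta> \<le> \<phi>"
    using s_le \<phi> \<eta> \<theta> cos_monotone_0_pi[of \<phi> "\<eta> - \<theta>"] by force
  obtain u k where u: "norm u = 1" "ip (a *\<^sub>C x) u = complex_of_real k" "cos \<theta> \<le> k"
    "cmod (ip (b *\<^sub>C y) u) \<le> cos \<eta>"
  proof (cases "\<phi> < \<eta>")
    case True
    obtain u where u: "norm u = 1" "ip (a *\<^sub>C x) u = complex_of_real (cos (\<eta> - \<phi>))"
      "ip (b *\<^sub>C y) u = complex_of_real (cos \<eta>)"
      using unit_vector_at_angles[OF n, of \<phi> \<eta>] ip \<phi> le \<theta> True \<eta> by (auto simp: s_def)
    have "cos \<theta> \<le> cos (\<eta> - \<phi>)"
      using le True \<theta> \<eta> by (intro cos_monotone_0_pi_le) auto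
    moreover have "cos \<eta> \<ge> 0" using \<eta> by (intro cos_ge_zero) auto
    ultimately show ?thesis using u that by auto
  next
    case False
    then have "s \<le> cos \<eta>" using \<phi> \<eta> cos_monotone_0_pi_le[of \<eta> \<phi>] by simp
    moreover have "ip (b *\<^sub>C y) (a *\<^sub>C x) = complex_of_real s"
      using conj[of "b *\<^sub>C y" "a *\<^sub>C x"] ip by (simp add: s_def)
    moreover have "ip (a *\<^sub>C x) (a *\<^sub>C x) = complex_of_real 1" using n by (simp add: self)
    ultimately show ?thesis using that[of "a *\<^sub>C x" 1] n s by simp
  qed
  have xu: "ip x u = complex_of_real (k * norm x)"
    using u(2) xy by (simp add: scale_left a field_simps)
  show ?thesis
  proof
    show "ip x u \<in> \<real>" unfolding xu by (rule Reals_of_real)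
    show "cos \<theta> * norm x \<le> Re (ip x u)" unfolding xu using u by (simp add: mult_right_mono)
    show "cmod (ip y u) \<le> cos \<eta> * norm y"
      using u(4) xy by (simp add: scale_left norm_mult b field_simps)
  qed (use u in auto)
qed

end

section \<open>Equivalent forms of norming approximate orthogonality\<close>

theorem theorem1p3:
  fixes x y :: "'a::complex_normed_vector" and \<delta> \<epsilon> :: real
  assumes "x \<noteq> 0" and "y \<noteq> 0"
    and "\<delta> \<in> {0..<1}" and "\<epsilon> \<in> {0..<1}" and "\<epsilon> < (1 - \<delta>)\<^sup>2"
  shows
    "(norming_approx_orth \<delta> \<epsilon> x y \<longleftrightarrow>
       (\<exists>f \<in> topological_dual - {\<lambda>_. 0}.
          f x \<in> \<real> \<and> Re (f x) \<ge> (1 - \<delta>) * onorm f * norm x \<and>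
          cmod (f y) \<le> \<epsilon> / (1 - \<delta>) * onorm f * norm y)) \<and>
     (norming_approx_orth \<delta> \<epsilon> x y \<longleftrightarrow>
       (\<exists>f \<in> topological_dual - {\<lambda>_. 0}.
          Re (f x) \<ge> (1 - \<delta>) * onorm f * norm x \<and>
          cmod (f y) \<le> \<epsilon> / (1 - \<delta>) * onorm f * norm y)) \<and>
     (norming_approx_orth \<delta> \<epsilon> x y \<longleftrightarrow>
       (\<forall>c::complex. norm (x + c *\<^sub>C y) \<ge>
          (1 - \<delta>) * norm x - \<epsilon> / (1 - \<delta>) * cmod c * norm y)) \<and>
     (\<forall>ip :: 'a \<Rightarrow> 'a \<Rightarrow> complex. hilbert_space_with ip \<longrightarrow>
       (norming_approx_orth \<delta> \<epsilon> x y \<longleftrightarrow>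
          cmod (ip x y) \<le> L_const \<delta> \<epsilon> * norm x * norm y) \<and>
       (norming_approx_orth \<delta> \<epsilon> x y \<longleftrightarrow>
          (\<exists>u \<in> sphere 0 1.
             ip x u \<in> \<real> \<and> Re (ip x u) \<ge> (1 - \<delta>) * norm x \<and>
             cmod (ip y u) \<le> \<epsilon> / (1 - \<delta>) * norm y)))"
    (is "(?i \<longleftrightarrow> ?ii) \<and> (?i \<longleftrightarrow> ?iii) \<and> (?i \<longleftrightarrow> ?iv) \<and> (\<forall>ip. _ ip \<longrightarrow> (?i \<longleftrightarrow> ?v ip) \<and> (?i \<longleftrightarrow> ?vi ip))")
proof -
  let ?m = "\<epsilon> / (1 - \<delta>)"
  have \<delta>: "0 \<le> \<delta>" "\<delta> < 1" and \<epsilon>: "0 \<le> \<epsilon>" "\<epsilon> < (1 - \<delta>)\<^sup>2" using assms by auto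
  have m: "0 \<le> ?m" "?m < 1 - \<delta>"
    using \<delta> \<epsilon> by (auto simp: pos_divide_less_eq power2_eq_square)
  have i_ii: "?i \<Longrightarrow> ?ii"
  proof -
    assume ?i
    then obtain f where f: "f \<in> topological_dual - {\<lambda>_. 0}"
      "cmod (f x) \<ge> (1 - \<delta>) * onorm f * norm x" "cmod (f y) \<le> ?m * onorm f * norm y"
      unfolding norming_approx_orth_def by blast
    obtain g where "g \<in> topological_dual - {\<lambda>_. 0}" "onorm g = onorm f"
      "g x = complex_of_real (cmod (f x))" "\<And>z. cmod (g z) = cmod (f z)"
      using rotate_functional[OF f(1)] by metis
    then show ?ii using f by (intro bexI[of _ g]) auto
  qed
  have ii_iii: "?ii \<Longrightarrow> ?iii" by blast
  have iii_i: "?iii \<Longrightarrow> ?i"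
    unfolding norming_approx_orth_def using complex_Re_le_cmod order_trans by blast
  have i_iv: "?i \<Longrightarrow> ?iv"
    unfolding norming_approx_orth_def using norm_ge_of_functional by blast
  have iv_iii: "?iv \<Longrightarrow> ?iii"
  proof -
    assume iv: ?iv
    have gap: "?m * norm y * norm x < (1 - \<delta>) * norm x * norm y"
      using mult_strict_right_mono[OF m(2), of "norm x * norm y"] assms(1,2) by (simp add: ac_simps)
    have dist: "(1 - \<delta>) * norm x \<le> norm (x + c *\<^sub>C y) + ?m * norm y * cmod c" for c
      using iv[rule_format, of c] by (simp add: algebra_simps)
    have "0 \<le> ?m * norm y" using m(1) by (intro mult_nonneg_nonneg) auto
    then obtain F where F: "F \<in> topological_dual" "onorm F = 1" "(1 - \<delta>) * norm x \<le> Re (F x)"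
        "cmod (F y) \<le> ?m * norm y"
      using ex_functional_norm_one[OF _ gap dist] by blast
    moreover have "F \<noteq> (\<lambda>_. 0)" using F(2) by (auto simp: onorm_zero)
    ultimately show ?iii by (intro bexI[of _ F]) auto
  qed
  have hilbert: "(?i \<longleftrightarrow> ?v ip) \<and> (?i \<longleftrightarrow> ?vi ip)" if "hilbert_space_with ip" for ip
  proof -
    interpret complex_inner_product ip
      using that unfolding hilbert_space_with_def by unfold_locales blast+
    let ?\<theta> = "angle_delta \<delta>" and ?\<eta> = "angle_eps \<delta> \<epsilon>"
    have \<theta>: "0 \<le> ?\<theta>" "?\<theta> < pi / 2" "cos ?\<theta> = 1 - \<delta>"
      using angle_delta_iff[OF \<delta>, of ?\<theta>] by auto
    have \<eta>: "0 < ?\<eta>" "?\<eta> \<le> pi / 2" "cos ?\<eta> = ?m"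
      using angle_eps_iff[OF \<delta> \<epsilon>, of ?\<eta>] by auto
    have \<theta>\<eta>: "?\<theta> < ?\<eta>"
      using m \<theta> \<eta> cos_monotone_0_pi_le[of ?\<eta> ?\<theta>] by force
    have iv_v: "?iv \<Longrightarrow> ?v ip"
      using angle_bound_of_norm_bound[OF assms(1,2) \<eta>(1,2) \<theta>(1)] \<theta>\<eta> \<theta> \<eta>
      by (simp add: L_const_def)
    have v_vi: "?v ip \<Longrightarrow> ?vi ip"
    proof -
      assume "?v ip"
      then obtain u where "norm u = 1" "ip x u \<in> \<real>" "cos ?\<theta> * norm x \<le> Re (ip x u)"
          "cmod (ip y u) \<le> cos ?\<eta> * norm y"
        using ex_unit_vector_of_angle_bound[OF assms(1,2) \<eta>(1,2) \<theta>(1) \<theta>\<eta>] unfolding L_const_def by blast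
      then show "?vi ip" using \<theta> \<eta> by (intro bexI[of _ u]) auto
    qed
    have vi_iii: "?vi ip \<Longrightarrow> ?iii"
    proof -
      assume "?vi ip"
      then obtain u where u: "norm u = 1" "Re (ip x u) \<ge> (1 - \<delta>) * norm x" "cmod (ip y u) \<le> ?m * norm y"
        by auto
      then show ?iii using functional_of_vector[OF u(1)] by (intro bexI[of _ "\<lambda>z. ip z u"]) auto
    qed
    show ?thesis using iv_v v_vi vi_iii iii_i i_iv by blast
  qed
  show ?thesis
  proof (intro conjI allI impI)
    show "?i \<longleftrightarrow> ?ii" using i_ii ii_iii iii_i by blast
    show "?i \<longleftrightarrow> ?iii" using i_ii ii_iii iii_i by blast
    show "?i \<longleftrightarrow> ?iv" using i_iv iv_iii iii_i by blast
  qed (use hilbert in blast)+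
qed

end
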